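(* Let $n\ge0$, $k>0$ and $i\in\{0,1\}$. Every irreducible component $C$ of the set $\{(c,a)\in\mathbb{C}^2:\ P^{n+k}_{c,a}(c_i)=P^n_{c,a}(c_i)\}$ contains infinitely many post-critically finite parameters.
   Context: $P_{c,a}(z)=\frac13z^3-\frac c2z^2+a^3$ with critical points $c_0=0$, $c_1=c$; a parameter is post-critically finite if both critical points have finite forward orbits. *)

theory Defs
  imports Complex_Main "HOL-Computational_Algebra.Polynomial"
begin

definition Pca :: "complex \<Rightarrow> complex \<Rightarrow> complex \<Rightarrow> complex" where
  "Pca c a z = z ^ 3 / 3 - c / 2 * z ^ 2 + a ^ 3"

definition crit :: "complex \<Rightarrow> nat \<Rightarrow> complex" where
  "crit c i = (if i = 0 then 0 else c)"

definition pcf :: "complex \<times> complex \<Rightarrow> bool" where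
  "pcf p = (case p of (c, a) \<Rightarrow>
      finite (range (\<lambda>m. (Pca c a ^^ m) 0)) \<and> finite (range (\<lambda>m. (Pca c a ^^ m) c)))"

text \<open>Polynomials in two variables (c,a), represented as polynomials in c
  with coefficients polynomials in a.\<close>
definition poly2 :: "complex poly poly \<Rightarrow> complex \<times> complex \<Rightarrow> complex" where
  "poly2 p z = poly (map_poly (\<lambda>q. poly q (snd z)) p) (fst z)"

definition zariski_closed :: "(complex \<times> complex) set \<Rightarrow> bool" where
  "zariski_closed S \<longleftrightarrow> (\<exists>F. finite F \<and> S = {z. \<forall>p\<in>F. poly2 p z = 0})"

definition irreducible_alg :: "(complex \<times> complex) set \<Rightarrow> bool" where
  "irreducible_alg V \<longleftrightarrow> zariski_closed V \<and> V \<noteq> {} \<and>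
     (\<forall>A B. zariski_closed A \<and> zariski_closed B \<and> V = A \<union> B \<longrightarrow> V = A \<or> V = B)"

definition irreducible_component :: "(complex \<times> complex) set \<Rightarrow> (complex \<times> complex) set \<Rightarrow> bool" where
  "irreducible_component C X \<longleftrightarrow> C \<subseteq> X \<and> irreducible_alg C \<and>
     (\<forall>D. irreducible_alg D \<and> C \<subseteq> D \<and> D \<subseteq> X \<longrightarrow> D = C)"

end

theory Submission
  imports Defs "HOL-Computational_Algebra.Computational_Algebra"
    "HOL-Computational_Algebra.Field_as_Ring"
begin

text \<open>
  Let \<open>c_j\<close> be the critical point other than \<open>c_i\<close>, and put \<open>u_m = P^m(c_j) - c_j\<close>. If \<open>C\<close> contained
  only finitely many post-critically finite parameters, then the parameters of \<open>C\<close> at which \<open>c_j\<close> is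
  periodic would have a common period \<open>M\<close>. Since \<open>c_j\<close> is critical, \<open>P^M(c_j + u) - P^M(c_j)\<close> is
  divisible by \<open>u^2\<close>, so \<open>u_{2M} = u_M w\<close> with \<open>w = 1 + u_M h\<close>. A zero of \<open>w\<close> on \<open>C\<close> would be a zero
  of \<open>u_{2M}\<close>, hence of \<open>u_M\<close>, where \<open>w = 1\<close>; so \<open>w\<close> has no zero on \<open>C\<close>.

  On the other hand, \<open>C\<close> is the zero set of a prime polynomial that is monic in \<open>a\<close> up to a scalar, and
  \<open>w\<close> tends to infinity along \<open>C\<close> as \<open>c\<close> does: the orbit of \<open>c_i\<close> being bounded, that of \<open>c_j\<close>
  must escape. The product of the values of \<open>w\<close> over the points of \<open>C\<close> above \<open>c\<close> is, by Newton's
  identities, a polynomial in \<open>c\<close>. It tends to infinity, so it has a zero, which is a contradiction.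
\<close>

section \<open>Newton's identities and norms\<close>

text \<open>\<open>E d\<close> is the characteristic polynomial reversed. The identity compares
  coefficients in E' = -S E, where S is the generating function of the power sums, the sum of the
  x_i / (1 - x_i t).\<close>

lemma newton_identities:
  fixes x :: "nat \<Rightarrow> complex"
  defines "E \<equiv> \<lambda>d. \<Prod>i<d. [:1, - x i:]"
  shows "of_nat (Suc m) * coeff (E d) (Suc m)
       = - (\<Sum>j\<le>m. (\<Sum>i<d. x i ^ Suc j) * coeff (E d) (m - j))"
proof -
  define S where "S = (\<lambda>d. Abs_fps (\<lambda>m. \<Sum>i<d. x i ^ Suc m))"
  have geo: "Abs_fps (\<lambda>m. y ^ Suc m) * fps_of_poly [:1, - y:] = fps_const y" for y :: complex
  proof (rule fps_ext)
    fix m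
    have "Abs_fps (\<lambda>m. y ^ Suc m) * fps_of_poly [:1, - y:]
        = Abs_fps (\<lambda>m. y ^ Suc m) - fps_X * (fps_const y * Abs_fps (\<lambda>m. y ^ Suc m))"
      by (simp add: fps_of_poly_pCons algebra_simps flip: fps_const_neg)
    then show "fps_nth (Abs_fps (\<lambda>m. y ^ Suc m) * fps_of_poly [:1, - y:]) m = fps_nth (fps_const y) m"
      by (cases m) auto
  qed
  have "fps_deriv (fps_of_poly (E d)) = - S d * fps_of_poly (E d)" for d
  proof (induction d)
    case 0
    then show ?case by (simp add: E_def S_def flip: fps_zero_def)
  next
    case (Suc d)
    have S: "S (Suc d) = S d + Abs_fps (\<lambda>m. x d ^ Suc m)"
      by (rule fps_ext) (simp add: S_def)
    have E: "fps_of_poly (E (Suc d)) = fps_of_poly (E d) * fps_of_poly [:1, - x d:]"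
      by (simp add: E_def fps_of_poly_mult)
    have "fps_deriv (fps_of_poly (E (Suc d)))
        = - S d * fps_of_poly (E d) * fps_of_poly [:1, - x d:] - fps_const (x d) * fps_of_poly (E d)"
      unfolding E by (simp add: Suc fps_of_poly_pCons algebra_simps flip: fps_const_neg)
    also have "\<dots> = - S (Suc d) * fps_of_poly (E (Suc d))"
      unfolding S E by (subst geo[symmetric]) (simp add: algebra_simps)
    finally show ?case .
  qed
  from arg_cong[OF this, of "\<lambda>f. fps_nth f m"] show ?thesis
    by (simp add: fps_mult_nth S_def sum_negf atLeast0AtMost del: power_Suc)
qed

lemma coeff_prod_0: "coeff (\<Prod>i\<in>I. p i) 0 = (\<Prod>i\<in>I. coeff (p i) 0)"
  by (simp add: poly_prod flip: poly_0_coeff_0)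

text \<open>A predicate on functions, because roots will be chosen separately for each c, with no
  regularity; only their symmetric functions are polynomial in c.\<close>

definition polyfun :: "(complex \<Rightarrow> complex) \<Rightarrow> bool" where
  "polyfun \<phi> \<longleftrightarrow> (\<exists>p. \<phi> = poly p)"

lemma polyfun_poly [intro]: "polyfun (poly p)"
  and polyfun_const [intro]: "polyfun (\<lambda>c. k)"
  by (auto simp: polyfun_def fun_eq_iff intro: exI[of _ "[:k:]"])

lemma polyfun_add [intro]: "polyfun \<phi> \<Longrightarrow> polyfun \<psi> \<Longrightarrow> polyfun (\<lambda>c. \<phi> c + \<psi> c)"
  and polyfun_mult [intro]: "polyfun \<phi> \<Longrightarrow> polyfun \<psi> \<Longrightarrow> polyfun (\<lambda>c. \<phi> c * \<psi> c)"
  by (auto simp: polyfun_def fun_eq_iff) (metis poly_add, metis poly_mult)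

lemma polyfun_uminus [intro]: "polyfun \<phi> \<Longrightarrow> polyfun (\<lambda>c. - \<phi> c)"
  using polyfun_mult[OF polyfun_const[of "-1"]] by simp

lemma polyfun_sum [intro]: "(\<And>j. j \<in> J \<Longrightarrow> polyfun (\<phi> j)) \<Longrightarrow> polyfun (\<lambda>c. \<Sum>j\<in>J. \<phi> j c)"
  by (induction J rule: infinite_finite_induct) auto

lemma polyfun_power_sums:
  fixes x :: "complex \<Rightarrow> nat \<Rightarrow> complex"
  assumes "\<And>m. polyfun (\<lambda>c. coeff (\<Prod>i<d. [:1, - x c i:]) m)"
  shows "polyfun (\<lambda>c. \<Sum>i<d. x c i ^ m)"
proof (induction m rule: less_induct)
  case (less m)
  show ?case
  proof (cases m)
    case 0
    then show ?thesis by auto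
  next
    case (Suc k)
    let ?e = "\<lambda>m c. coeff (\<Prod>i<d. [:1, - x c i:]) m"
    \<comment> \<open>The term \<open>j = k\<close> in Newton's identity carries the constant
      coefficient 1, so the newest power sum can be isolated.\<close>
    have eq: "(\<lambda>c. \<Sum>i<d. x c i ^ m)
        = (\<lambda>c. - (of_nat (Suc k) * ?e (Suc k) c
                   + (\<Sum>j<k. (\<Sum>i<d. x c i ^ Suc j) * ?e (k - j) c)))"
      using newton_identities[of k "x c" d for c]
      by (simp add: fun_eq_iff Suc coeff_prod_0 flip: lessThan_Suc_atMost del: of_nat_Suc power_Suc)
    show ?thesis
      unfolding eq
      by (intro polyfun_uminus polyfun_add polyfun_mult polyfun_sum assms polyfun_const less)
        (auto simp: Suc)
  qed
qed

lemma polyfun_elementary_symmetric: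
  fixes x :: "complex \<Rightarrow> nat \<Rightarrow> complex"
  assumes "\<And>m. polyfun (\<lambda>c. \<Sum>i<d. x c i ^ m)"
  shows "polyfun (\<lambda>c. coeff (\<Prod>i<d. [:1, - x c i:]) m)"
proof (induction m rule: less_induct)
  case (less m)
  show ?case
  proof (cases m)
    case 0
    then show ?thesis by (auto simp: coeff_prod_0)
  next
    case (Suc k)
    let ?e = "\<lambda>m c. coeff (\<Prod>i<d. [:1, - x c i:]) m"
    have eq: "?e m = (\<lambda>c. - (1 / of_nat (Suc k)) * (\<Sum>j\<le>k. (\<Sum>i<d. x c i ^ Suc j) * ?e (k - j) c))"
      using newton_identities[of k "x c" d for c]
      by (simp add: fun_eq_iff Suc field_simps del: of_nat_Suc power_Suc)
    show ?thesis
      unfolding eq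
      by (intro polyfun_uminus polyfun_add polyfun_mult polyfun_sum assms polyfun_const less)
        (auto simp: Suc)
  qed
qed

text \<open>This makes a norm, up to sign, the last elementary symmetric function, to which
  \<open>polyfun_elementary_symmetric\<close> applies.\<close>

lemma coeff_prod_linear_top:
  fixes x :: "nat \<Rightarrow> complex"
  shows "coeff (\<Prod>i<d. [:1, - x i:]) d = (\<Prod>i<d. - x i)"
proof (induction d)
  case (Suc d)
  have "degree (\<Prod>i<d. [:1, - x i:]) \<le> (\<Sum>i<d. degree [:1, - x i:])"
    using degree_prod_sum_le[of "{..<d}" "\<lambda>i. [:1, - x i:]"] by (simp add: comp_def)
  also have "\<dots> \<le> d" by (rule order_trans[OF sum_mono[of _ _ "\<lambda>_. 1"]]) auto
  finally have "coeff (\<Prod>i<d. [:1, - x i:]) (Suc d) = 0" by (intro coeff_eq_0) auto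
  with Suc show ?case by (simp add: mult.commute)
qed simp

text \<open>A bivariate polynomial is regarded as a polynomial in \<open>a\<close> with coefficients in \<open>\<complex>[c]\<close>, the
  opposite of the convention of \<^const>\<open>poly2\<close>: the curves at hand are monic in \<open>a\<close> up to a scalar,
  but not in \<open>c\<close>.\<close>

definition ev :: "complex poly poly \<Rightarrow> complex \<Rightarrow> complex \<Rightarrow> complex" where
  "ev p c a = poly (poly p [:a:]) c"

definition zeros :: "complex poly poly \<Rightarrow> (complex \<times> complex) set" where
  "zeros p = {(c, a). ev p c a = 0}"

text \<open>The degree in a then never drops when c is specialized. Scalars are allowed because P
  has leading coefficient 1/3 and because prime factors are determined only up to units.\<close>

definition monic_upto_scalar :: "complex poly poly \<Rightarrow> bool" where
  "monic_upto_scalar p \<longleftrightarrow> (\<exists>k. k \<noteq> 0 \<and> lead_coeff p = [:k:])"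

lemma ev_simps [simp]:
  "ev (p + q) c a = ev p c a + ev q c a" "ev (p - q) c a = ev p c a - ev q c a"
  "ev (p * q) c a = ev p c a * ev q c a" "ev (p ^ m) c a = ev p c a ^ m"
  "ev (- p) c a = - ev p c a" "ev 0 c a = 0" "ev 1 c a = 1" "ev (pCons r p) c a = poly r c + a * ev p c a"
  "ev (smult r p) c a = poly r c * ev p c a"
  by (simp_all add: ev_def)

lemma poly_map_poly_poly: "poly (map_poly (\<lambda>q. poly q c) p) a = poly (poly p [:a:]) c"
  by (induction p) (auto simp: map_poly_pCons)

lemma ev_eq_poly: "ev p c a = poly (map_poly (\<lambda>q. poly q c) p) a"
  by (simp add: ev_def poly_map_poly_poly)

lemma specialize:
  assumes "lead_coeff p = [:k:]" "k \<noteq> 0"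
  shows "degree (map_poly (\<lambda>q. poly q c) p) = degree p"
    and "lead_coeff (map_poly (\<lambda>q. poly q c) p) = k"
proof -
  show *: "degree (map_poly (\<lambda>q. poly q c) p) = degree p"
    using assms by (intro map_poly_degree_eq) simp
  show "lead_coeff (map_poly (\<lambda>q. poly q c) p) = k"
    unfolding * using assms by (simp add: coeff_map_poly)
qed

lemma monic_upto_scalar_root:
  assumes "monic_upto_scalar p" "degree p > 0"
  shows "\<exists>a. ev p c a = 0"
proof -
  from assms have "degree (map_poly (\<lambda>q. poly q c) p) > 0"
    by (auto simp: monic_upto_scalar_def specialize)
  then show ?thesis
    unfolding ev_eq_poly by (metis constant_degree fundamental_theorem_of_algebra less_irrefl)
qed

lemma monic_upto_scalar_roots:
  assumes "monic_upto_scalar f"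
  obtains x where "\<And>c a. ev f c a = 0 \<longleftrightarrow> (\<exists>i<degree f. a = x c i)"
    and "\<And>m. polyfun (\<lambda>c. \<Sum>i<degree f. x c i ^ m)"
proof -
  from assms obtain k where k: "lead_coeff f = [:k:]" "k \<noteq> 0"
    by (auto simp: monic_upto_scalar_def)
  define F where "F = (\<lambda>c. map_poly (\<lambda>q. poly q c) f)"
  have F: "degree (F c) = degree f" "lead_coeff (F c) = k" for c
    unfolding F_def by (rule specialize[OF k])+
  have "\<exists>x. smult k (\<Prod>i<degree f. [:- x i, 1:]) = F c" for c
    using complex_poly_decompose'[of "F c"] F by metis
  then obtain x where x: "smult k (\<Prod>i<degree f. [:- x c i, 1:]) = F c" for c
    by metis
  have "ev f c a = 0 \<longleftrightarrow> (\<exists>i<degree f. a = x c i)" for c a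
  proof -
    have "ev f c a = k * (\<Prod>i<degree f. a - x c i)"
      using x[of c, symmetric] by (simp add: ev_eq_poly F_def poly_prod)
    then show ?thesis using k by auto
  qed
  moreover have "polyfun (\<lambda>c. coeff (\<Prod>i<degree f. [:1, - x c i:]) m)" for m
  proof -
    \<comment> \<open>Reversal turns the factors a - y into the form of Newton's identities.\<close>
    have "reflect_poly [:- y, 1:] = [:1, - y:]" for y :: complex
      by (cases "y = 0") (auto simp: reflect_poly_def)
    then have "coeff (reflect_poly (F c)) m = k * coeff (\<Prod>i<degree f. [:1, - x c i:]) m" for c
      unfolding x[symmetric] by (simp add: reflect_poly_smult reflect_poly_prod)
    \<comment> \<open>The case is explicit because \<open>degree f - m\<close> is cut off at 0 for
      large m.\<close>
    then have "coeff (\<Prod>i<degree f. [:1, - x c i:]) m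
        = (if m > degree f then 0 else 1 / k) * poly (coeff f (degree f - m)) c" for c
      using k by (auto simp: coeff_reflect_poly F F_def coeff_map_poly field_simps specialize[OF k])
    then show ?thesis by (auto simp only: intro!: polyfun_mult)
  qed
  ultimately show ?thesis by (intro that polyfun_power_sums)
qed

text \<open>The norm of \<open>w\<close> over \<open>\<complex>[c]\<close> is a polynomial in \<open>c\<close> that tends to infinity, hence has a zero.\<close>

lemma proper_polynomial_has_zero:
  assumes f: "monic_upto_scalar f" "degree f > 0"
    and proper: "\<And>B. \<exists>r. \<forall>c a. ev f c a = 0 \<and> cmod c \<ge> r \<longrightarrow> cmod (ev w c a) \<ge> B"
  shows "\<exists>c a. ev f c a = 0 \<and> ev w c a = 0"
proof (rule ccontr)
  assume no_zero: "\<not> ?thesis"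
  let ?d = "degree f"
  obtain x where x: "\<And>c a. ev f c a = 0 \<longleftrightarrow> (\<exists>i<?d. a = x c i)"
    and psum: "\<And>m. polyfun (\<lambda>c. \<Sum>i<?d. x c i ^ m)"
    using monic_upto_scalar_roots[OF f(1)] by blast
  \<comment> \<open>The extra power of the root makes the induction work: passing from h to
    \<open>pCons r h\<close> raises m by one.\<close>
  have trace: "polyfun (\<lambda>c. \<Sum>i<?d. x c i ^ m * ev h c (x c i))" for h m
  proof (induction h arbitrary: m)
    case 0
    then show ?case by auto
  next
    case (pCons r h)
    have eq: "(\<lambda>c. \<Sum>i<?d. x c i ^ m * ev (pCons r h) c (x c i))
        = (\<lambda>c. poly r c * (\<Sum>i<?d. x c i ^ m) + (\<Sum>i<?d. x c i ^ Suc m * ev h c (x c i)))"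
      by (auto simp: sum_distrib_left algebra_simps sum.distrib)
    show ?case
      unfolding eq by (intro polyfun_add polyfun_mult polyfun_poly psum pCons)
  qed
  have "polyfun (\<lambda>c. coeff (\<Prod>i<?d. [:1, - ev w c (x c i):]) ?d)"
    using trace[of 0 "w ^ m" for m] by (intro polyfun_elementary_symmetric) simp
  then obtain N where N: "(\<Prod>i<?d. - ev w c (x c i)) = poly N c" for c
    unfolding coeff_prod_linear_top polyfun_def by metis
  have "poly N c \<noteq> 0" for c
    using no_zero x by (auto simp flip: N)
  then have "constant (poly N)"
    using fundamental_theorem_of_algebra by blast
  then obtain K where K: "poly N c = K" for c
    by (auto simp: constant_def)
  obtain r where r: "ev f c a = 0 \<Longrightarrow> cmod c \<ge> r \<Longrightarrow> cmod (ev w c a) \<ge> cmod K + 1" for c a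
    using proper by blast
  define c where "c = complex_of_real \<bar>r\<bar>"
  have "cmod c \<ge> r" by (simp add: c_def)
  have "cmod K = (\<Prod>i<?d. cmod (ev w c (x c i)))"
    using N[of c] prod_norm[of "\<lambda>i. - ev w c (x c i)" "{..<?d}"] by (simp add: K)
  also have "\<dots> \<ge> (\<Prod>i<?d. cmod K + 1)"
    using x \<open>cmod c \<ge> r\<close> by (intro prod_mono conjI r) auto
  finally have "(cmod K + 1) ^ ?d \<le> cmod K" by simp
  moreover have "(cmod K + 1) ^ 1 \<le> (cmod K + 1) ^ ?d"
    using f(2) by (intro power_increasing) auto
  ultimately show False by simp
qed

section \<open>Irreducible components of plane curves\<close>

lemma poly2_eq: "poly2 p (c, a) = poly (poly p [:c:]) a"
  by (simp add: poly2_def poly_map_poly_poly)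

text \<open>The two encodings differ by exchanging inner and outer variable;
  \<open>[:[:0, 1:]:]\<close> is the inner one, which is c for \<open>ev\<close>.\<close>

lemma poly2_imp_ev: "\<exists>q. \<forall>c a. poly2 p (c, a) = ev q c a"
proof (induction p)
  case 0
  show ?case by (intro exI[of _ 0]) (simp add: poly2_eq)
next
  case (pCons r p)
  then obtain q where q: "\<And>c a. poly2 p (c, a) = ev q c a" by blast
  have r: "ev (map_poly (\<lambda>x. [:x:]) r) c a = poly r a" for c a
    by (induction r) (auto simp: map_poly_pCons)
  show ?case
    by (intro exI[of _ "map_poly (\<lambda>x. [:x:]) r + [:[:0, 1:]:] * q"])
      (use q in \<open>simp add: r poly2_eq\<close>)
qed

lemma ev_imp_poly2: "\<exists>q. \<forall>c a. ev p c a = poly2 q (c, a)"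
proof (induction p)
  case 0
  show ?case by (intro exI[of _ 0]) (simp add: poly2_eq)
next
  case (pCons r p)
  then obtain q where q: "\<And>c a. ev p c a = poly2 q (c, a)" by blast
  have r: "poly (poly (map_poly (\<lambda>x. [:x:]) r) [:c:]) a = poly r c" for c a :: complex
    by (induction r) (auto simp: map_poly_pCons)
  show ?case
    by (intro exI[of _ "map_poly (\<lambda>x. [:x:]) r + [:[:0, 1:]:] * q"])
      (use q in \<open>simp add: r poly2_eq\<close>)
qed

section \<open>Zariski closed sets and prime factors\<close>

lemma zariski_closed_zeros: "zariski_closed (zeros p)"
proof -
  obtain q where "\<And>c a. ev p c a = poly2 q (c, a)" using ev_imp_poly2 by blast
  then show ?thesis
    unfolding zariski_closed_def by (intro exI[of _ "{q}"]) (auto simp: zeros_def)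
qed

lemma zariski_closed_Int:
  assumes "zariski_closed A" "zariski_closed B"
  shows "zariski_closed (A \<inter> B)"
proof -
  from assms obtain F G where "finite F" "A = {z. \<forall>p\<in>F. poly2 p z = 0}"
    "finite G" "B = {z. \<forall>p\<in>G. poly2 p z = 0}"
    by (auto simp: zariski_closed_def)
  then show ?thesis
    unfolding zariski_closed_def by (intro exI[of _ "F \<union> G"]) auto
qed

lemma zariski_closed_separate:
  assumes "zariski_closed A" "z \<notin> A"
  obtains p where "A \<subseteq> zeros p" "z \<notin> zeros p"
proof -
  from assms obtain q where q: "\<And>y. y \<in> A \<Longrightarrow> poly2 q y = 0" "poly2 q z \<noteq> 0"
    by (auto simp: zariski_closed_def)
  obtain p where p: "\<And>c a. poly2 q (c, a) = ev p c a" using poly2_imp_ev by blast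
  show ?thesis
    using q by (intro that[of p]) (auto simp: zeros_def p)
qed

lemma zeros_mult: "zeros (p * q) = zeros p \<union> zeros q"
  by (auto simp: zeros_def)

lemma zeros_dvd_mono: "p dvd q \<Longrightarrow> zeros p \<subseteq> zeros q"
  by (auto simp: zeros_mult elim!: dvdE)

lemma irreducible_alg_subset_cases:
  assumes "irreducible_alg C" "C \<subseteq> zeros p \<union> zeros q"
  shows "C \<subseteq> zeros p \<or> C \<subseteq> zeros q"
proof -
  from assms have "zariski_closed (C \<inter> zeros r)" for r
    by (auto simp: irreducible_alg_def intro: zariski_closed_Int zariski_closed_zeros)
  moreover have "C = C \<inter> zeros p \<union> C \<inter> zeros q" using assms by auto
  ultimately show ?thesis
    using assms(1) unfolding irreducible_alg_def by (metis inf.absorb_iff1)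
qed

text \<open>The units of \<complex>[c] are the nonzero constants, and every factor of a unit is a
  unit.\<close>

lemma monic_upto_scalar_factor:
  assumes "monic_upto_scalar (p * q)"
  shows "monic_upto_scalar p"
proof -
  from assms obtain k where k: "k \<noteq> 0" "lead_coeff p * lead_coeff q = [:k:]"
    by (auto simp: monic_upto_scalar_def lead_coeff_mult)
  then have "is_unit (lead_coeff p * lead_coeff q)" by (simp add: is_unit_triv)
  then have "is_unit (lead_coeff p)" by (rule is_unit_mult_iff[THEN iffD1, THEN conjunct1])
  then show ?thesis
    by (auto simp: monic_upto_scalar_def is_unit_poly_iff)
qed

text \<open>The Nullstellensatz for a curve that is monic in \<open>a\<close>: let \<open>g\<close> be an element of least degree
  in the ideal \<open>(f, p)\<close>. It cannot have degree zero, for it would be a nonzero polynomial in \<open>c\<close>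
  vanishing at every \<open>c\<close>; so by pseudo-division the prime \<open>f\<close> divides \<open>g\<close> and hence \<open>p\<close>.\<close>

lemma prime_elem_dvd_of_vanishing:
  assumes prime: "prime_elem f" and monic: "monic_upto_scalar f" "degree f > 0"
    and vanish: "zeros f \<subseteq> zeros p"
  shows "f dvd p"
proof -
  define I where "I = {g. g \<noteq> 0 \<and> (\<exists>r s. g = r * f + s * p)}"
  have "f \<in> I"
    using monic(2) unfolding I_def by (force intro: exI[of _ 1] exI[of _ 0])
  then obtain g where g: "g \<in> I" and least: "\<And>h. h \<in> I \<Longrightarrow> degree g \<le> degree h"
    using ex_has_least_nat[of "\<lambda>h. h \<in> I" f degree] by blast
  have not_dvd: "\<not> f dvd [:r:]" if "r \<noteq> 0" for r
    using dvd_imp_degree_le[of f "[:r:]"] monic that by auto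
  have "ev g c a = 0" if "ev f c a = 0" for c a
    using that vanish g by (auto simp: I_def zeros_def)
  then have root: "\<exists>a. ev g c a = 0" for c
    using monic_upto_scalar_root[OF monic] by blast
  have deg: "degree g > 0"
  proof (rule ccontr)
    assume "\<not> ?thesis"
    then obtain r where r: "g = [:r:]" by (auto elim: degree_eq_zeroE)
    with root have "poly r = poly 0" by auto
    then have "r = 0" by (simp only: poly_eq_poly_eq_iff)
    with r g show False by (simp add: I_def)
  qed
  \<comment> \<open>The pseudo-remainder of h by g stays in the ideal and has smaller degree, so
    minimality forces it to be 0.\<close>
  have divides: "\<exists>b q. b \<noteq> 0 \<and> [:b:] * h = g * q" if h: "\<exists>r s. h = r * f + s * p" for h
  proof -
    have "g \<noteq> 0" using g by (simp add: I_def)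
    from pseudo_mod[OF this, of h] obtain b q where
      b: "b \<noteq> 0" "smult b h = g * q + pseudo_mod h g"
      and small: "pseudo_mod h g = 0 \<or> degree (pseudo_mod h g) < degree g" by blast
    from h obtain r s where rs: "h = r * f + s * p" by blast
    from g obtain r' s' where rs': "g = r' * f + s' * p" by (auto simp: I_def)
    define b' where "b' = [:b:]"
    have "pseudo_mod h g = b' * h - g * q" using b by (simp add: b'_def)
    also have "\<dots> = (b' * r - q * r') * f + (b' * s - q * s') * p"
      unfolding rs rs' by (simp add: algebra_simps)
    finally have "pseudo_mod h g = 0 \<or> pseudo_mod h g \<in> I"
      unfolding I_def by blast
    with small least[of "pseudo_mod h g"] have "pseudo_mod h g = 0" by auto
    with b show ?thesis by auto
  qed
  have "f dvd g"
  proof -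
    obtain b q where b: "b \<noteq> 0" "[:b:] * f = g * q"
      using divides[of f] by (force intro: exI[of _ 1] exI[of _ 0])
    then have "f dvd g * q" using dvd_triv_right[of f "[:b:]"] by simp
    \<comment> \<open>Otherwise cancelling f would exhibit g, of positive degree in a, as a divisor
      of the nonzero polynomial b in c alone.\<close>
    moreover have "\<not> f dvd q"
    proof
      assume "f dvd q"
      then obtain q' where "q = f * q'" ..
      with b have "[:b:] * f = g * q' * f" by (simp add: ac_simps)
      with monic(2) have *: "[:b:] = g * q'" by (auto simp: mult_cancel_right simp del: mult_pCons_left)
      with b(1) have "g \<noteq> 0" "q' \<noteq> 0" by auto
      with deg arg_cong[OF *, of degree] show False by (simp add: degree_mult_eq)
    qed
    ultimately show ?thesis using prime by (simp add: prime_elem_dvd_mult_iff)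
  qed
  moreover obtain b q where b: "b \<noteq> 0" "[:b:] * p = g * q"
    using divides[of p] by (force intro: exI[of _ 1] exI[of _ 0])
  ultimately have "f dvd [:b:] * p" by (simp only: dvd_mult2)
  with not_dvd[OF b(1)] show ?thesis using prime prime_elem_dvd_mult_iff by blast
qed

lemma irreducible_alg_zeros:
  assumes f: "prime_elem f" "monic_upto_scalar f" "degree f > 0"
  shows "irreducible_alg (zeros f)"
  unfolding irreducible_alg_def
proof (intro conjI allI impI)
  show "zariski_closed (zeros f)" by (rule zariski_closed_zeros)
  show "zeros f \<noteq> {}"
    using monic_upto_scalar_root[OF f(2,3)] by (auto simp: zeros_def)
  fix A B
  assume AB: "zariski_closed A \<and> zariski_closed B \<and> zeros f = A \<union> B"
  show "zeros f = A \<or> zeros f = B"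
  proof (rule ccontr)
    assume "\<not> ?thesis"
    with AB obtain y z where "y \<in> zeros f" "y \<notin> A" "z \<in> zeros f" "z \<notin> B" by blast
    obtain p where p: "A \<subseteq> zeros p" "y \<notin> zeros p"
      using AB \<open>y \<notin> A\<close> zariski_closed_separate by blast
    obtain q where q: "B \<subseteq> zeros q" "z \<notin> zeros q"
      using AB \<open>z \<notin> B\<close> zariski_closed_separate by blast
    have "f dvd p * q"
      using AB p q by (intro prime_elem_dvd_of_vanishing[OF f]) (auto simp: zeros_mult)
    then have "f dvd p \<or> f dvd q" using f(1) by (simp add: prime_elem_dvd_mult_iff)
    with zeros_dvd_mono p q \<open>y \<in> zeros f\<close> \<open>z \<in> zeros f\<close> show False by blast
  qed
qed

text \<open>By irreducibility C lies in the zero set of one prime factor of Q. That set is itself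
  irreducible, so maximality of C gives equality.\<close>

lemma irreducible_component_eq_zeros:
  assumes C: "irreducible_component C (zeros Q)" and Q: "monic_upto_scalar Q"
  obtains f where "C = zeros f" "monic_upto_scalar f" "degree f > 0"
proof -
  have irr: "irreducible_alg C" and sub: "C \<subseteq> zeros Q"
    using C by (auto simp: irreducible_component_def)
  have "Q \<noteq> 0" using Q by (auto simp: monic_upto_scalar_def)
  then obtain A where A: "\<And>f. f \<in># A \<Longrightarrow> prime f" "normalize (prod_mset A) = normalize Q"
    using prime_factorization_exists' by blast
  from A(2) have "Q dvd prod_mset A" "prod_mset A dvd Q" by (auto dest: associatedD1 associatedD2)
  have pick: "C \<subseteq> zeros (prod_mset B) \<Longrightarrow> \<exists>f. f \<in># B \<and> C \<subseteq> zeros f" for B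
  proof (induction B)
    case empty
    moreover have "C \<noteq> {}" using irr by (simp add: irreducible_alg_def)
    ultimately show ?case by (auto simp: zeros_def)
  next
    case (add f B)
    then show ?case
      using irreducible_alg_subset_cases[OF irr, of f "prod_mset B"] by (auto simp: zeros_mult)
  qed
  have "C \<subseteq> zeros (prod_mset A)"
    using sub zeros_dvd_mono[OF \<open>Q dvd prod_mset A\<close>] by blast
  then obtain f where f: "f \<in># A" "C \<subseteq> zeros f" using pick by blast
  have "f dvd Q" using f(1) \<open>prod_mset A dvd Q\<close> by (meson dvd_prod_mset dvd_trans)
  then have monic: "monic_upto_scalar f" using Q monic_upto_scalar_factor by (auto elim!: dvdE)
  have prime: "prime_elem f" using A f by auto
  have deg: "degree f > 0"
  proof (rule ccontr)
    assume "\<not> ?thesis"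
    with monic have "is_unit f"
      by (auto simp: monic_upto_scalar_def is_unit_const_poly_iff dvd_field_iff elim!: degree_eq_zeroE)
    with prime show False by auto
  qed
  have "zeros f = C"
    using C irreducible_alg_zeros[OF prime monic deg] f(2) zeros_dvd_mono[OF \<open>f dvd Q\<close>]
    by (simp add: irreducible_component_def)
  with monic deg show ?thesis by (intro that) auto
qed

section \<open>Growth of the critical orbits\<close>

definition lift_Pca :: "complex poly poly \<Rightarrow> complex poly poly" where
  "lift_Pca z = [:[:1/3:]:] * z ^ 3 - [:[:0, 1/2:]:] * z ^ 2 + [:0, 1:] ^ 3"

definition lift_crit :: "nat \<Rightarrow> complex poly poly" where
  "lift_crit i = (if i = 0 then 0 else [:[:0, 1:]:])"

definition crit_orbit :: "nat \<Rightarrow> nat \<Rightarrow> complex poly poly" where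
  "crit_orbit i m = (lift_Pca ^^ m) (lift_crit i)"

lemma ev_lift_Pca: "ev (lift_Pca z) c a = Pca c a (ev z c a)"
  by (simp add: lift_Pca_def Pca_def)

lemma ev_lift_crit [simp]: "ev (lift_crit i) c a = crit c i"
  by (simp add: lift_crit_def crit_def)

lemma ev_crit_orbit [simp]: "ev (crit_orbit i m) c a = (Pca c a ^^ m) (crit c i)"
  by (induction m) (simp_all add: crit_orbit_def ev_lift_Pca)

text \<open>The degree in a of the cubic term exceeds those of the quadratic term and of a^3, so
  nothing cancels its leading coefficient.\<close>

lemma lift_Pca_monic:
  assumes "monic_upto_scalar z" "degree z \<ge> 3"
  shows "monic_upto_scalar (lift_Pca z)" "degree (lift_Pca z) = 3 * degree z"
proof -
  from assms(1) obtain k where k: "k \<noteq> 0" "lead_coeff z = [:k:]"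
    by (auto simp: monic_upto_scalar_def)
  define y where "y = [:[:1/3:]:] * z ^ 3"
  define x where "x = [:0, 1:] ^ 3 - [:[:0, 1/2:]:] * z ^ 2"
  have eq: "lift_Pca z = x + y" by (simp add: lift_Pca_def x_def y_def)
  have "z \<noteq> 0" using assms by auto
  then have y: "degree y = 3 * degree z"
    by (simp add: y_def degree_power_eq)
  have "lead_coeff y = [:1/3:] * [:k:] ^ 3"
    unfolding y_def lead_coeff_mult lead_coeff_power k by simp
  also have "\<dots> = [:k ^ 3 / 3:]"
    by (simp add: eval_nat_numeral)
  finally have lc: "lead_coeff y = [:k ^ 3 / 3:]" .
  have "degree ([:[:0, 1/2:]:] * z ^ 2) \<le> 2 * degree z"
    using \<open>z \<noteq> 0\<close> by (simp add: degree_power_eq)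
  moreover have "degree ([:0, 1:] ^ 3 :: complex poly poly) = 3"
    by (simp add: degree_power_eq)
  ultimately have "degree x < degree y"
    unfolding x_def using assms(2) y
    by (intro le_less_trans[OF degree_diff_le_max]) (auto simp: max_def)
  then have "degree (x + y) = degree y" "lead_coeff (x + y) = lead_coeff y"
    by (rule degree_add_eq_right, rule lead_coeff_add_le)
  then show "monic_upto_scalar (lift_Pca z)" "degree (lift_Pca z) = 3 * degree z"
    unfolding eq monic_upto_scalar_def using y lc k
    by (auto simp del: coeff_add intro!: exI[of _ "k ^ 3 / 3"])
qed

lemma crit_orbit_monic:
  "monic_upto_scalar (crit_orbit i (Suc m)) \<and> degree (crit_orbit i (Suc m)) = 3 ^ Suc m"
proof (induction m)
  case 0
  \<comment> \<open>The critical values are a^3 and a^3 - c^3/6.\<close>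
  have "lift_Pca (lift_crit i) = (if i = 0 then [:0, 0, 0, 1:] else [:[:0, 0, 0, -1/6:], 0, 0, 1:])"
    by (simp add: lift_Pca_def lift_crit_def eval_nat_numeral)
  then show ?case by (auto simp: crit_orbit_def monic_upto_scalar_def intro!: exI[of _ 1])
next
  case (Suc m)
  have "3 ^ 1 \<le> (3::nat) ^ Suc m" by (rule power_increasing) auto
  with Suc lift_Pca_monic[of "crit_orbit i (Suc m)"] show ?case
    by (simp add: crit_orbit_def)
qed

lemma preperiodicity_polynomial_monic:
  assumes "k > 0"
  shows "monic_upto_scalar (crit_orbit i (n + k) - crit_orbit i n)"
proof -
  obtain m where m: "n + k = Suc m" using assms by (cases "n + k") auto
  have "degree (- crit_orbit i n) < degree (crit_orbit i (n + k))"
  \<comment> \<open>The case n = 0 is separate: the critical point itself does not involve a, so its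
    degree is 0 and not \<open>3 ^ 0\<close>.\<close>
  proof (cases n)
    case 0
    then have "degree (- crit_orbit i n) = 0" by (simp add: crit_orbit_def lift_crit_def)
    then show ?thesis using crit_orbit_monic[of i m] by (simp add: m)
  next
    case (Suc l)
    have "(3::nat) ^ n < 3 ^ (n + k)" using assms by (intro power_strict_increasing) auto
    with crit_orbit_monic[of i m] crit_orbit_monic[of i l] show ?thesis
      unfolding m[symmetric] Suc[symmetric] degree_minus by metis
  qed
  then have "lead_coeff (- crit_orbit i n + crit_orbit i (n + k)) = lead_coeff (crit_orbit i (n + k))"
    by (rule lead_coeff_add_le)
  moreover have "- crit_orbit i n + crit_orbit i (n + k) = crit_orbit i (n + k) - crit_orbit i n"
    by simp
  ultimately show ?thesis
    using crit_orbit_monic[of i m, THEN conjunct1] by (simp only: monic_upto_scalar_def m)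
qed

section \<open>Escape of large orbits\<close>

text \<open>With r = |z| the terms in c and a are at most r^3/8 and r^3/64. The cubic term r^3/3
  thus leaves at least r^3/6, which exceeds r^2.\<close>

lemma Pca_escape:
  assumes c: "cmod c \<le> R" and a: "cmod a \<le> R" and z: "4 * R \<le> cmod z" and R: "10 \<le> R"
  shows "cmod z ^ 2 \<le> cmod (Pca c a z)"
proof -
  define r where "r = cmod z"
  have r: "40 \<le> r" "cmod c \<le> r / 4" "cmod a \<le> r / 4" using assms by (auto simp: r_def)
  have 1: "cmod (z ^ 3 / 3) = r ^ 3 / 3" by (simp add: r_def norm_divide norm_power)
  have 2: "cmod (c / 2 * z ^ 2) \<le> r ^ 3 / 8"
  proof -
    have "cmod (c / 2 * z ^ 2) = cmod c * (r ^ 2 / 2)" by (simp add: r_def norm_mult norm_divide norm_power)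
    also have "\<dots> \<le> r / 4 * (r ^ 2 / 2)" using r by (intro mult_right_mono) auto
    finally show ?thesis by (simp add: eval_nat_numeral)
  qed
  have 3: "cmod (a ^ 3) \<le> r ^ 3 / 64"
    using power_mono[OF r(3), of 3] by (simp add: norm_power power_divide)
  have "cmod (z ^ 3 / 3) \<le> cmod (Pca c a z) + cmod (c / 2 * z ^ 2) + cmod (a ^ 3)"
    using norm_triangle_ineq4[of "Pca c a z + c / 2 * z ^ 2" "a ^ 3"]
      norm_triangle_ineq[of "Pca c a z" "c / 2 * z ^ 2"]
    by (simp add: Pca_def)
  moreover have "r ^ 3 \<ge> 0" using r by simp
  ultimately have "r ^ 3 / 6 \<le> cmod (Pca c a z)" using 1 2 3 by linarith
  moreover have "r ^ 2 * 6 \<le> r ^ 2 * r" using r by (intro mult_left_mono) auto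
  then have "r ^ 2 \<le> r ^ 3 / 6" by (simp add: eval_nat_numeral)
  ultimately show ?thesis by (simp add: r_def)
qed

lemma Pca_orbit_escape:
  assumes c: "cmod c \<le> R" and a: "cmod a \<le> R" and z: "4 * R \<le> cmod z" and R: "10 \<le> R"
  shows "cmod z \<le> cmod ((Pca c a ^^ m) z)"
    and "cmod ((Pca c a ^^ m) z) ^ 2 \<le> cmod ((Pca c a ^^ Suc m) z)"
proof -
  have grow: "cmod z \<le> cmod (Pca c a y)" "cmod y ^ 2 \<le> cmod (Pca c a y)" if "cmod z \<le> cmod y" for y
  proof -
    show "cmod y ^ 2 \<le> cmod (Pca c a y)" using that assms by (intro Pca_escape) auto
    moreover have "cmod y \<le> cmod y ^ 2"
      using that assms self_le_power[of "cmod y" 2] by auto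
    ultimately show "cmod z \<le> cmod (Pca c a y)" using that by linarith
  qed
  show *: "cmod z \<le> cmod ((Pca c a ^^ m) z)" for m
    by (induction m) (simp_all add: grow)
  show "cmod ((Pca c a ^^ m) z) ^ 2 \<le> cmod ((Pca c a ^^ Suc m) z)"
    using grow[OF *] by simp
qed

lemma Pca_orbit_escape_strict_mono:
  assumes "cmod c \<le> R" "cmod a \<le> R" "4 * R \<le> cmod z" "10 \<le> R"
  shows "strict_mono (\<lambda>m. cmod ((Pca c a ^^ m) z))"
proof (rule strict_mono_Suc_iff[THEN iffD2], intro allI)
  fix m
  have "1 < cmod ((Pca c a ^^ m) z)"
    using Pca_orbit_escape(1)[OF assms, of m] assms by linarith
  then have "cmod ((Pca c a ^^ m) z) ^ 1 < cmod ((Pca c a ^^ m) z) ^ 2"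
    by (intro power_strict_increasing) auto
  with Pca_orbit_escape(2)[OF assms, of m]
  show "cmod ((Pca c a ^^ m) z) < cmod ((Pca c a ^^ Suc m) z)" by simp
qed

lemma preperiodic_critical_value_bound:
  assumes "cmod c \<le> R" "cmod a \<le> R" "10 \<le> R" "k > 0"
    and "(Pca c a ^^ (n + k)) z = (Pca c a ^^ n) z"
  shows "cmod (Pca c a z) < 4 * R"
proof (rule ccontr)
  assume "\<not> ?thesis"
  then have "strict_mono (\<lambda>m. cmod ((Pca c a ^^ m) (Pca c a z)))"
    using assms by (intro Pca_orbit_escape_strict_mono) auto
  then have "cmod ((Pca c a ^^ n) (Pca c a z)) < cmod ((Pca c a ^^ (n + k)) (Pca c a z))"
    by (rule strict_monoD) (use assms in simp)
  moreover have "(Pca c a ^^ m) (Pca c a z) = Pca c a ((Pca c a ^^ m) z)" for m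
    by (simp add: funpow_swap1)
  ultimately show False using assms(5) by simp
qed

text \<open>One of c and a has modulus R, and the two critical values differ by c^3/6. If one value
  is at most 4R, the other is therefore of order R^3.\<close>

lemma other_critical_value_large:
  assumes i: "i \<in> {0, 1}" and R: "R = max (cmod c) (cmod a)" "10 \<le> R"
    and small: "cmod (Pca c a (crit c i)) \<le> 4 * R"
  shows "R ^ 2 \<le> cmod (Pca c a (crit c (1 - i)))"
proof -
  have v: "Pca c a 0 = a ^ 3" "Pca c a c = a ^ 3 - c ^ 3 / 6"
    by (simp_all add: Pca_def eval_nat_numeral)
  have "R ^ 2 * 10 \<le> R ^ 2 * R" using R by (intro mult_left_mono) auto
  then have R3: "R ^ 2 * 10 \<le> R ^ 3" by (simp add: eval_nat_numeral)
  have "R * 10 \<le> R * R" using R by (intro mult_left_mono) auto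
  then have R2: "R * 10 \<le> R ^ 2" by (simp add: eval_nat_numeral)
  have tri: "cmod (c ^ 3 / 6) \<le> cmod (a ^ 3) + cmod (a ^ 3 - c ^ 3 / 6)"
    using norm_triangle_ineq4[of "a ^ 3" "a ^ 3 - c ^ 3 / 6"] by simp
  have "cmod c = R \<or> cmod a = R" using R by auto
  then have large: "cmod (c ^ 3 / 6) = R ^ 3 / 6 \<or> cmod (a ^ 3) = R ^ 3"
    by (auto simp: norm_divide norm_power)
  from i consider "i = 0" | "i = 1" by auto
  then show ?thesis
  proof cases
    case 1
    with small have "cmod (a ^ 3) \<le> 4 * R" by (simp add: crit_def v)
    with tri large R(2) R2 R3 have "R ^ 2 \<le> cmod (a ^ 3 - c ^ 3 / 6)" by linarith
    with 1 show ?thesis by (simp add: crit_def v)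
  next
    case 2
    with small R(2) have "cmod (a ^ 3 - c ^ 3 / 6) \<le> 4 * R" by (auto simp: crit_def v)
    with tri large R(2) R2 R3 have "R ^ 2 \<le> cmod (a ^ 3)" by linarith
    with 2 show ?thesis by (simp add: crit_def v)
  qed
qed

section \<open>Periodicity of the free critical point\<close>

lemma Pca_diff: "Pca c a (x + y) = Pca c a x + y * (x ^ 2 + x * y + y ^ 2 / 3 - c * x - c * y / 2)"
  by (simp add: Pca_def field_simps eval_nat_numeral)

text \<open>At a critical point the linear term of P vanishes, so the first iterate changes by a
  multiple of u^2. By \<open>Pca_diff\<close> each further application of P multiplies that change
  by a polynomial.\<close>

lemma iterate_Pca_near_crit:
  fixes u :: "complex poly poly"
  shows "\<exists>h. \<forall>c a. (Pca c a ^^ Suc m) (crit c j + ev u c a)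
     = (Pca c a ^^ Suc m) (crit c j) + ev u c a ^ 2 * ev h c a"
proof (induction m)
  case 0
  show ?case
    \<comment> \<open>The witness is u/3 + P''/2, where P'' equals -c at 0 and c at c.\<close>
    by (intro exI[of _ "[:[:1/3:]:] * u + (if j = 0 then - 1 else 1) * [:[:0, 1/2:]:]"])
      (auto simp: Pca_def crit_def field_simps eval_nat_numeral)
next
  case (Suc m)
  then obtain h where h: "\<And>c a. (Pca c a ^^ Suc m) (crit c j + ev u c a)
     = (Pca c a ^^ Suc m) (crit c j) + ev u c a ^ 2 * ev h c a" by blast
  define x where "x = crit_orbit j (Suc m)"
  define y where "y = u ^ 2 * h"
  define g where "g = x ^ 2 + x * y + [:[:1/3:]:] * y ^ 2 - [:[:0, 1:]:] * x - [:[:0, 1/2:]:] * y"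
  have "(Pca c a ^^ Suc (Suc m)) (crit c j + ev u c a)
      = (Pca c a ^^ Suc (Suc m)) (crit c j) + ev u c a ^ 2 * ev (h * g) c a" for c a
  proof -
    have "(Pca c a ^^ Suc (Suc m)) (crit c j + ev u c a) = Pca c a (ev x c a + ev y c a)"
      using h[of c a] by (simp add: x_def y_def)
    also have "\<dots> = Pca c a (ev x c a) + ev y c a * ev g c a"
      unfolding Pca_diff by (simp add: g_def)
    finally show ?thesis by (simp add: x_def y_def mult.assoc)
  qed
  then show ?case by blast
qed

lemma return_map_cofactor:
  assumes "M > 0"
  obtains w h where
    "\<And>c a. ev w c a = 1 + ((Pca c a ^^ M) (crit c j) - crit c j) * ev h c a"
    "\<And>c a. (Pca c a ^^ (M + M)) (crit c j) - crit c j
        = ((Pca c a ^^ M) (crit c j) - crit c j) * ev w c a"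
proof -
  obtain m where m: "M = Suc m" using assms by (cases M) auto
  define u where "u = crit_orbit j M - lift_crit j"
  obtain h where h: "\<And>c a. (Pca c a ^^ M) (crit c j + ev u c a)
     = (Pca c a ^^ M) (crit c j) + ev u c a ^ 2 * ev h c a"
    using iterate_Pca_near_crit unfolding m by blast
  have u: "(Pca c a ^^ M) (crit c j) = crit c j + ev u c a" for c a
    by (simp add: u_def)
  have "(Pca c a ^^ (M + M)) (crit c j) = crit c j + ev u c a + ev u c a ^ 2 * ev h c a" for c a
    unfolding funpow_add comp_apply u h by simp
  then show ?thesis
    by (intro that[of "1 + u * h" h]) (simp_all add: u algebra_simps power2_eq_square)
qed

lemma finite_orbit:
  fixes f :: "'a \<Rightarrow> 'a"
  assumes "(f ^^ (n + k)) z = (f ^^ n) z" "k > 0"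
  shows "finite (range (\<lambda>m. (f ^^ m) z))"
proof -
  have "(f ^^ m) z \<in> (\<lambda>m. (f ^^ m) z) ` {..<n + k}" for m
  proof (induction m rule: less_induct)
    case (less m)
    show ?case
    proof (cases "m < n + k")
      case False
      then obtain l where l: "m = l + (n + k)" by (metis add.commute le_Suc_ex not_less)
      have "(f ^^ (l + p)) z = (f ^^ l) ((f ^^ p) z)" for p
        by (simp add: funpow_add)
      then have "(f ^^ m) z = (f ^^ (l + n)) z"
        by (simp only: l assms(1))
      with less[of "l + n"] assms(2) show ?thesis by (simp add: l)
    qed auto
  qed
  then have "range (\<lambda>m. (f ^^ m) z) \<subseteq> (\<lambda>m. (f ^^ m) z) ` {..<n + k}" by blast
  then show ?thesis by (rule finite_subset) simp
qed

lemma funpow_periodic_mult: "(f ^^ m) z = z \<Longrightarrow> (f ^^ (m * l)) z = z"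
  by (induction l) (simp_all add: funpow_add)

text \<open>For x = P^M(c_j) and y = P^{2M}(c_j) escape gives |y| >= |x|^2 and |x| >= 10 R. Since
  |c_j| <= R, the quotient w of y - c_j by x - c_j has modulus at least R.\<close>

lemma cofactor_large:
  assumes "k > 0" "i \<in> {0, 1}" "(Pca c a ^^ (n + k)) (crit c i) = (Pca c a ^^ n) (crit c i)"
    and M: "M > 0" and R: "10 \<le> cmod c"
    and w: "(Pca c a ^^ (M + M)) (crit c (1 - i)) - crit c (1 - i)
        = ((Pca c a ^^ M) (crit c (1 - i)) - crit c (1 - i)) * w"
  shows "cmod c \<le> cmod w"
proof -
  define R where "R = max (cmod c) (cmod a)"
  define v where "v = Pca c a (crit c (1 - i))"
  have Rb: "cmod c \<le> R" "cmod a \<le> R" "10 \<le> R" using R by (auto simp: R_def)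
  have "R * 10 \<le> R * R" using Rb by (intro mult_left_mono) auto
  then have R2: "R * 10 \<le> R ^ 2" by (simp add: eval_nat_numeral)
  have "R ^ 2 \<le> cmod v"
    unfolding v_def
    using preperiodic_critical_value_bound[OF Rb assms(1,3)] assms(2) Rb
    by (intro other_critical_value_large) (auto simp: R_def)
  with R2 Rb have v: "R * 10 \<le> cmod v" "4 * R \<le> cmod v" by auto
  obtain m where m: "M = Suc m" using M by (cases M) auto
  define x where "x = (Pca c a ^^ m) v"
  define y where "y = (Pca c a ^^ (m + M)) v"
  have x: "cmod v \<le> cmod x" "cmod x ^ 2 \<le> cmod (Pca c a x)"
    using Pca_orbit_escape[OF Rb(1,2) v(2) Rb(3), of m] by (simp_all add: x_def)
  have "Suc m \<le> m + M" by (simp add: m)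
  then have "cmod ((Pca c a ^^ Suc m) v) \<le> cmod y"
    unfolding y_def
    by (rule strict_mono_less_eq[OF Pca_orbit_escape_strict_mono[OF Rb(1,2) v(2) Rb(3)], THEN iffD2])
  with x(2) have y: "cmod x ^ 2 \<le> cmod y" by (simp add: x_def)
  have "y - crit c (1 - i) = (x - crit c (1 - i)) * w"
    using w by (simp add: m x_def y_def v_def funpow_swap1)
  then have eq: "cmod (y - crit c (1 - i)) = cmod (x - crit c (1 - i)) * cmod w"
    by (simp add: norm_mult)
  have crit: "cmod (crit c (1 - i)) \<le> R" using Rb by (auto simp: crit_def)
  define X where "X = cmod x"
  have X: "R * 10 \<le> X" "X ^ 2 \<le> cmod y" using v x y by (auto simp: X_def)
  have "X * (R * 10) \<le> X * X" using X Rb by (intro mult_left_mono) auto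
  then have "X * R * 10 \<le> X ^ 2" by (simp add: power2_eq_square)
  moreover have "X * 1 \<le> X * R" using X Rb by (intro mult_left_mono) auto
  moreover have "cmod (y - crit c (1 - i)) \<ge> X ^ 2 - R"
    using norm_triangle_ineq2[of y "crit c (1 - i)"] crit X by linarith
  ultimately have "2 * X * R \<le> cmod (y - crit c (1 - i))" using X Rb by linarith
  also have "\<dots> \<le> (2 * X) * cmod w"
    unfolding eq using norm_triangle_ineq4[of x "crit c (1 - i)"] crit X Rb
    by (intro mult_right_mono) (auto simp: X_def)
  finally have "R \<le> cmod w" using X Rb by simp
  with Rb show ?thesis by simp
qed

theorem lemma5p2:
  fixes n k i :: nat and C :: "(complex \<times> complex) set"
  assumes "k > 0" and "i \<in> {0, 1}"
    and "irreducible_component C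
           {(c, a). (Pca c a ^^ (n + k)) (crit c i) = (Pca c a ^^ n) (crit c i)}"
  shows "infinite {p \<in> C. pcf p}"
proof
  let ?j = "1 - i"
  assume fin: "finite {p \<in> C. pcf p}"
  have X: "{(c, a). (Pca c a ^^ (n + k)) (crit c i) = (Pca c a ^^ n) (crit c i)}
      = zeros (crit_orbit i (n + k) - crit_orbit i n)"
    by (auto simp: zeros_def)
  obtain f where f: "C = zeros f" "monic_upto_scalar f" "degree f > 0"
    using irreducible_component_eq_zeros[OF assms(3)[unfolded X] preperiodicity_polynomial_monic[OF assms(1)]] .
  have preper: "(Pca c a ^^ (n + k)) (crit c i) = (Pca c a ^^ n) (crit c i)" if "(c, a) \<in> C" for c a
    using assms(3) that by (auto simp: irreducible_component_def)
  \<comment> \<open>On C the point c_i is already preperiodic, so periodicity of c_j gives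
    post-critical finiteness.\<close>
  define T where "T = {p \<in> C. \<exists>m>0. (Pca (fst p) (snd p) ^^ m) (crit (fst p) ?j) = crit (fst p) ?j}"
  have "pcf p" if "p \<in> T" for p
  proof -
    obtain c a where p: "p = (c, a)" by (cases p)
    from that obtain m where "m > 0" "(Pca c a ^^ (0 + m)) (crit c ?j) = (Pca c a ^^ 0) (crit c ?j)"
      and "(c, a) \<in> C"
      by (auto simp: T_def p)
    then have "finite (range (\<lambda>m. (Pca c a ^^ m) (crit c ?j)))"
      and "finite (range (\<lambda>m. (Pca c a ^^ m) (crit c i)))"
      using finite_orbit[of 0 m "Pca c a"] finite_orbit[OF preper assms(1)] by simp_all
    with assms(2) show ?thesis by (auto simp: p pcf_def crit_def)
  qed
  then have "finite T" by (intro finite_subset[OF _ fin]) (auto simp: T_def)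
  obtain per where per: "\<And>p. p \<in> T \<Longrightarrow> per p > 0"
    "\<And>p. p \<in> T \<Longrightarrow> (Pca (fst p) (snd p) ^^ per p) (crit (fst p) ?j) = crit (fst p) ?j"
    using bchoice[of T "\<lambda>p m. m > 0 \<and> (Pca (fst p) (snd p) ^^ m) (crit (fst p) ?j) = crit (fst p) ?j"]
    unfolding T_def by blast
  \<comment> \<open>A common period for all of T; the empty product 1 serves when T is
    empty.\<close>
  define M :: nat where "M = (\<Prod>p\<in>T. per p)"
  have "M > 0" using per(1) by (simp add: M_def prod_pos)
  have M: "(Pca c a ^^ M) (crit c ?j) = crit c ?j" if T: "(c, a) \<in> T" for c a
  proof -
    obtain l where "M = per (c, a) * l"
      using dvd_prodI[OF \<open>finite T\<close> T, of per] by (auto simp: M_def)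
    with per(2)[OF T] show ?thesis by (simp add: funpow_periodic_mult)
  qed
  obtain w h where w: "\<And>c a. ev w c a = 1 + ((Pca c a ^^ M) (crit c ?j) - crit c ?j) * ev h c a"
    and fact: "\<And>c a. (Pca c a ^^ (M + M)) (crit c ?j) - crit c ?j
        = ((Pca c a ^^ M) (crit c ?j) - crit c ?j) * ev w c a"
    using return_map_cofactor[OF \<open>M > 0\<close>] by blast
  have "\<exists>r. \<forall>c a. ev f c a = 0 \<and> cmod c \<ge> r \<longrightarrow> cmod (ev w c a) \<ge> B" for B
  proof (intro exI allI impI)
    fix c a
    assume *: "ev f c a = 0 \<and> cmod c \<ge> max 10 B"
    then have "cmod c \<le> cmod (ev w c a)"
      using preper by (intro cofactor_large[OF assms(1,2) _ \<open>M > 0\<close> _ fact]) (auto simp: f zeros_def)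
    with * show "cmod (ev w c a) \<ge> B" by simp
  qed
  from proper_polynomial_has_zero[OF f(2,3) this] obtain c a where
    ca: "ev f c a = 0" "ev w c a = 0" by blast
  \<comment> \<open>A zero of w makes c_j periodic, which puts the point in T. Then M is already a
    period, and w = 1 there.\<close>
  have "(Pca c a ^^ (M + M)) (crit c ?j) = crit c ?j" using fact[of c a] ca by simp
  with ca \<open>M > 0\<close> have "(c, a) \<in> T"
    by (auto simp: T_def f zeros_def intro!: exI[of _ "M + M"])
  from M[OF this] w[of c a] ca show False by simp
qed

end
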